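(* There is a constant $C>0$ such that for all integers $k\ge 2$ and all positive integers $n,m$, $$nm-2\sqrt{2}\sqrt{nm}-C(\sqrt{n}+\sqrt{m})\ \le\ \mathrm{HB2}_k(n,m).$$
   Context: A two-dimensional partial word of size $n$ by $m$ over an alphabet $A$ is a map $w:\{0,\dots,n-1\}\times\{0,\dots,m-1\}\to A\cup\{\diamondsuit\}$, where $\diamondsuit\notin A$ is a hole; its domain $\mathrm{D}(w)$ is the set of positions $p$ with $w(p)\in A$. An $(n,m)$-ruler is a subset $R\subseteq\{0,\dots,n-1\}\times\{0,\dots,m-1\}$ such that every $(x,y)\in\mathbb{Z}^2$ with $|x|\le n-1$, $|y|\le m-1$ equals $r_1-r_2$ for some $r_1,r_2\in R$. The two-dimensional partial word $w$ is unbordered if $\mathrm{D}(w)$ is an $(n,m)$-ruler and for every nonzero vector $v$ with $|v_1|\le n-1$, $|v_2|\le m-1$ there exist $r_1,r_2\in\mathrm{D}(w)$ with $r_1-r_2=v$ and $w(r_1)\ne w(r_2)$. $\mathrm{HB2}_k(n,m)$ denotes the maximum number of holes an $n$ by $m$ unbordered two-dimensional partial word over an alphabet of size $k$ can have. *)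

theory Defs
  imports Complex_Main "HOL-Library.FuncSet" "HOL-Library.Product_Plus"
begin

definition grid :: "nat \<Rightarrow> nat \<Rightarrow> (int \<times> int) set" where
  "grid n m = {0..<int n} \<times> {0..<int m}"

text \<open>The hole is \<^const>\<open>None\<close>; a letter \<open>a\<close> of the alphabet is \<open>Some a\<close>.\<close>

definition partial_words :: "'a set \<Rightarrow> nat \<Rightarrow> nat \<Rightarrow> (int \<times> int \<Rightarrow> 'a option) set" where
  "partial_words A n m = grid n m \<rightarrow>\<^sub>E insert None (Some ` A)"

definition word_dom :: "nat \<Rightarrow> nat \<Rightarrow> (int \<times> int \<Rightarrow> 'a option) \<Rightarrow> (int \<times> int) set" where
  "word_dom n m w = {p \<in> grid n m. w p \<noteq> None}"

definition num_holes :: "nat \<Rightarrow> nat \<Rightarrow> (int \<times> int \<Rightarrow> 'a option) \<Rightarrow> nat" where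
  "num_holes n m w = card {p \<in> grid n m. w p = None}"

definition ruler :: "nat \<Rightarrow> nat \<Rightarrow> (int \<times> int) set \<Rightarrow> bool" where
  "ruler n m R \<longleftrightarrow> R \<subseteq> grid n m \<and>
     (\<forall>x y. \<bar>x\<bar> \<le> int n - 1 \<and> \<bar>y\<bar> \<le> int m - 1 \<longrightarrow>
        (\<exists>r1\<in>R. \<exists>r2\<in>R. (x, y) = r1 - r2))"

definition unbordered :: "nat \<Rightarrow> nat \<Rightarrow> (int \<times> int \<Rightarrow> 'a option) \<Rightarrow> bool" where
  "unbordered n m w \<longleftrightarrow> ruler n m (word_dom n m w) \<and>
     (\<forall>v. v \<noteq> 0 \<and> \<bar>fst v\<bar> \<le> int n - 1 \<and> \<bar>snd v\<bar> \<le> int m - 1 \<longrightarrow>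
        (\<exists>r1\<in>word_dom n m w. \<exists>r2\<in>word_dom n m w. r1 - r2 = v \<and> w r1 \<noteq> w r2))"

definition hole_counts :: "'a set \<Rightarrow> nat \<Rightarrow> nat \<Rightarrow> nat set" where
  "hole_counts A n m = {num_holes n m w | w. w \<in> partial_words A n m \<and> unbordered n m w}"

text \<open>
  The value depends only on the size of the alphabet (lemma \<open>HB2_alphabet\<close>), so a standard
  alphabet of size \<open>k\<close> is used.  If no unbordered word exists (as for
  \<open>k = n = m = 2\<close>), the maximum is over the empty set and is an unspecified natural number.
\<close>

definition HB2 :: "nat \<Rightarrow> nat \<Rightarrow> nat \<Rightarrow> nat" where
  "HB2 k n m = Max (hole_counts {..<k} n m)"

lemma finite_grid [simp]: "finite (grid n m)"
  by (simp add: grid_def)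

lemma finite_hole_counts: "finite (hole_counts A n m)"
proof (rule finite_subset)
  show "hole_counts A n m \<subseteq> {..card (grid n m)}"
    by (auto simp: hole_counts_def num_holes_def intro!: card_mono)
qed simp

lemma hole_counts_mono_bij:
  assumes "bij_betw f A B"
  shows "hole_counts A n m \<subseteq> hole_counts B n m"
proof
  fix h assume "h \<in> hole_counts A n m"
  then obtain w where w: "w \<in> partial_words A n m" "unbordered n m w" "h = num_holes n m w"
    by (auto simp: hole_counts_def)
  define w' where "w' = restrict (\<lambda>p. map_option f (w p)) (grid n m)"
  have inj: "inj_on f A" and img: "f ` A = B"
    using assms by (auto simp: bij_betw_def)
  have letter: "w p = None \<or> (\<exists>a\<in>A. w p = Some a)" if "p \<in> grid n m" for p
    using PiE_mem[OF w(1)[unfolded partial_words_def] that] by auto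
  have w': "w' p = map_option f (w p)" if "p \<in> grid n m" for p
    using that by (simp add: w'_def)
  have dom: "word_dom n m w' = word_dom n m w"
    by (auto simp: word_dom_def w')
  have neq: "w' p \<noteq> w' q"
    if pq: "p \<in> word_dom n m w" "q \<in> word_dom n m w" "w p \<noteq> w q" for p q
  proof -
    have g: "p \<in> grid n m" "q \<in> grid n m" "w p \<noteq> None" "w q \<noteq> None"
      using pq by (simp_all add: word_dom_def)
    obtain a b where "a \<in> A" "b \<in> A" "w p = Some a" "w q = Some b"
      using letter[OF g(1)] letter[OF g(2)] g(3,4) by blast
    then show ?thesis
      using pq(3) inj by (simp add: w'[OF g(1)] w'[OF g(2)] inj_on_eq_iff)
  qed
  have "w' \<in> partial_words B n m"
    unfolding partial_words_def
  proof (rule PiE_I)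
    fix p assume "p \<in> grid n m"
    then show "w' p \<in> insert None (Some ` B)"
      using letter[of p] img by (auto simp: w')
  qed (simp add: w'_def)
  moreover have "unbordered n m w'"
    unfolding unbordered_def dom
  proof (intro conjI allI impI)
    show "ruler n m (word_dom n m w)"
      using w(2) by (simp add: unbordered_def)
  next
    fix v :: "int \<times> int"
    assume "v \<noteq> 0 \<and> \<bar>fst v\<bar> \<le> int n - 1 \<and> \<bar>snd v\<bar> \<le> int m - 1"
    then obtain r1 r2 where r: "r1 \<in> word_dom n m w" "r2 \<in> word_dom n m w" "r1 - r2 = v" "w r1 \<noteq> w r2"
      using w(2) unfolding unbordered_def by blast
    show "\<exists>r1\<in>word_dom n m w. \<exists>r2\<in>word_dom n m w. r1 - r2 = v \<and> w' r1 \<noteq> w' r2"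
      using r(1-3) neq[OF r(1,2,4)] by blast
  qed
  moreover have "{p \<in> grid n m. w' p = None} = {p \<in> grid n m. w p = None}"
    by (auto simp: w')
  then have "h = num_holes n m w'"
    using w(3) by (simp add: num_holes_def)
  ultimately show "h \<in> hole_counts B n m"
    by (auto simp: hole_counts_def)
qed

lemma HB2_alphabet:
  assumes "finite A" "card A = k"
  shows "HB2 k n m = Max (hole_counts A n m)"
proof -
  obtain f where f: "bij_betw f A {..<k}"
    using assms finite_same_card_bij[of A "{..<k}"] by auto
  have "hole_counts A n m = hole_counts {..<k} n m"
    using hole_counts_mono_bij[OF f] hole_counts_mono_bij[OF bij_betw_inv_into[OF f]] by blast
  then show ?thesis
    by (simp add: HB2_def)
qed

end

theory Submission
  imports Defs "HOL-Library.Discrete_Functions"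
begin

text \<open>
  A word over two letters is unbordered once every nonzero vector of the box is, up to sign, a
  difference between a position in the set \<open>A\<close> of the first letter and a position in the set \<open>B\<close>
  of the second. There are about \<open>2nm\<close> vectors up to sign, and a product construction covers them
  almost without repetition. It rests on one observation: \<open>p\<close> consecutive integers minus the
  multiples of \<open>p\<close> give every integer exactly once. Let \<open>q \<approx> \<surd>(n/2)\<close> and \<open>p \<approx> \<surd>m\<close>. In the first
  coordinate, \<open>A\<close> uses the last \<open>q\<close> rows and \<open>B\<close> the multiples of \<open>q\<close>, so that all positive
  differences occur; in the second, \<open>A\<close> uses the first \<open>p\<close> and the last \<open>p\<close> columns and \<open>B\<close> the
  multiples of \<open>p\<close>, so that all differences of both signs occur. Both sets have about
  \<open>\<surd>2 \<surd>(nm)\<close> elements. The vectors \<open>(0, y)\<close> are treated inside a single unused row, at a cost of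
  \<open>O(\<surd>m)\<close>.
\<close>

section \<open>Difference sets\<close>

definition differences :: "'a::minus set \<Rightarrow> 'a set \<Rightarrow> 'a set" where
  "differences A B = {a - b | a b. a \<in> A \<and> b \<in> B}"

lemma differencesI: "a \<in> A \<Longrightarrow> b \<in> B \<Longrightarrow> a - b \<in> differences A B"
  by (auto simp: differences_def)

lemma in_differences_iff: "v \<in> differences A B \<longleftrightarrow> (\<exists>a\<in>A. \<exists>b\<in>B. v = a - b)"
  by (auto simp: differences_def)

lemma differences_mono: "A \<subseteq> A' \<Longrightarrow> B \<subseteq> B' \<Longrightarrow> differences A B \<subseteq> differences A' B'"
  by (auto simp: differences_def)

lemma differences_Un_left: "differences (A \<union> A') B = differences A B \<union> differences A' B"
  by (auto simp: differences_def)

lemma differences_Times: "differences (A \<times> C) (B \<times> D) = differences A B \<times> differences C D"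
  by (fastforce simp: differences_def)

lemma uminus_in_differences_iff:
  fixes v :: "'a::group_add"
  shows "- v \<in> differences A B \<longleftrightarrow> v \<in> differences B A"
  by (auto simp: differences_def) (metis minus_diff_eq minus_minus)+

lemma in_differences_swap_iff:
  "v \<in> differences (prod.swap ` A) (prod.swap ` B) \<longleftrightarrow> prod.swap v \<in> differences A B"
  by (cases v) (force simp: differences_def)

section \<open>Unbordered words from difference covers\<close>

definition displacements :: "nat \<Rightarrow> nat \<Rightarrow> (int \<times> int) set" where
  "displacements n m = {- int n<..<int n} \<times> {- int m<..<int m}"

lemma in_displacements_iff:
  "v \<in> displacements n m \<longleftrightarrow> \<bar>fst v\<bar> \<le> int n - 1 \<and> \<bar>snd v\<bar> \<le> int m - 1"
  by (cases v) (auto simp: displacements_def)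

lemma ruler_iff_displacements_subset:
  "ruler n m R \<longleftrightarrow> R \<subseteq> grid n m \<and> displacements n m \<subseteq> differences R R"
  by (simp add: ruler_def subset_iff in_displacements_iff flip: in_differences_iff)

lemma unborderedI:
  assumes nonempty: "word_dom n m w \<noteq> {}"
    and separated: "\<And>v. v \<in> displacements n m \<Longrightarrow> v \<noteq> 0 \<Longrightarrow>
      \<exists>r1\<in>word_dom n m w. \<exists>r2\<in>word_dom n m w. r1 - r2 = v \<and> w r1 \<noteq> w r2"
  shows "unbordered n m w"
proof -
  let ?D = "word_dom n m w"
  have "v \<in> differences ?D ?D" if "v \<in> displacements n m" for v
  proof (cases "v = 0")
    case True
    obtain r where "r \<in> ?D" using nonempty by blast
    then show ?thesis using True differencesI[of r ?D r] by simp
  next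
    case False
    then show ?thesis using separated[OF that] differencesI by blast
  qed
  then have "ruler n m ?D"
    by (auto simp: ruler_iff_displacements_subset word_dom_def)
  then show ?thesis
    using separated by (auto simp: unbordered_def in_displacements_iff)
qed

definition difference_cover :: "nat \<Rightarrow> nat \<Rightarrow> (int \<times> int) set \<Rightarrow> (int \<times> int) set \<Rightarrow> bool" where
  "difference_cover n m A B \<longleftrightarrow> A \<subseteq> grid n m \<and> B \<subseteq> grid n m \<and> A \<inter> B = {} \<and> A \<noteq> {} \<and>
     (\<forall>v\<in>displacements n m. v \<noteq> 0 \<longrightarrow> v \<in> differences A B \<or> - v \<in> differences A B)"

lemma difference_cover_swap:
  assumes "difference_cover n m A B"
  shows "difference_cover m n (prod.swap ` A) (prod.swap ` B)"
proof -
  have "v \<in> differences (prod.swap ` A) (prod.swap ` B) \<or>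
      - v \<in> differences (prod.swap ` A) (prod.swap ` B)"
    if "v \<in> displacements m n" "v \<noteq> 0" for v
  proof -
    have "prod.swap v \<in> displacements n m" "prod.swap v \<noteq> 0" "- prod.swap v = prod.swap (- v)"
      using that by (cases v; auto simp: displacements_def zero_prod_def)+
    then show ?thesis
      using assms by (auto simp: difference_cover_def in_differences_swap_iff)
  qed
  then show ?thesis
    using assms by (auto simp: difference_cover_def grid_def)
qed

definition two_letter_word ::
  "nat \<Rightarrow> nat \<Rightarrow> (int \<times> int) set \<Rightarrow> (int \<times> int) set \<Rightarrow> int \<times> int \<Rightarrow> nat option" where
  "two_letter_word n m A B =
     restrict (\<lambda>p. if p \<in> A then Some 0 else if p \<in> B then Some 1 else None) (grid n m)"

lemma two_letter_word_in_partial_words: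
  "k \<ge> 2 \<Longrightarrow> two_letter_word n m A B \<in> partial_words {..<k} n m"
  by (auto simp: partial_words_def two_letter_word_def)

lemma num_holes_two_letter_word:
  assumes "A \<union> B \<subseteq> grid n m"
  shows "num_holes n m (two_letter_word n m A B) = n * m - card (A \<union> B)"
proof -
  have "{p \<in> grid n m. two_letter_word n m A B p = None} = grid n m - (A \<union> B)"
    by (auto simp: two_letter_word_def)
  moreover have "card (grid n m) = n * m"
    by (simp add: grid_def card_cartesian_product)
  ultimately show ?thesis
    using assms finite_subset[OF assms] by (simp add: num_holes_def card_Diff_subset)
qed

lemma unbordered_two_letter_word:
  assumes "difference_cover n m A B"
  shows "unbordered n m (two_letter_word n m A B)" (is "unbordered n m ?w")
proof (rule unborderedI)
  have grid: "A \<subseteq> grid n m" "B \<subseteq> grid n m" "A \<inter> B = {}" "A \<noteq> {}"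
    using assms by (simp_all add: difference_cover_def)
  have dom: "word_dom n m ?w = A \<union> B"
    using grid by (auto simp: word_dom_def two_letter_word_def)
  have letters: "?w a \<noteq> ?w b" if "a \<in> A" "b \<in> B" for a b
    using that grid by (auto simp: two_letter_word_def)
  show "word_dom n m ?w \<noteq> {}"
    using grid dom by simp
  fix v :: "int \<times> int"
  assume "v \<in> displacements n m" "v \<noteq> 0"
  then consider "v \<in> differences A B" | "v \<in> differences B A"
    using assms unfolding difference_cover_def uminus_in_differences_iff by blast
  then show "\<exists>r1\<in>word_dom n m ?w. \<exists>r2\<in>word_dom n m ?w. r1 - r2 = v \<and> ?w r1 \<noteq> ?w r2"
    unfolding dom using letters by cases (metis UnCI in_differences_iff)+
qed

lemma HB2_ge_if_difference_cover:
  assumes "difference_cover n m A B" "k \<ge> 2"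
  shows "n * m \<le> HB2 k n m + (card A + card B)"
proof -
  let ?w = "two_letter_word n m A B"
  have "?w \<in> partial_words {..<k} n m" "unbordered n m ?w"
    using assms by (simp_all add: two_letter_word_in_partial_words unbordered_two_letter_word)
  then have "num_holes n m ?w \<in> hole_counts {..<k} n m"
    unfolding hole_counts_def by (intro CollectI exI[of _ ?w] conjI refl)
  then have "num_holes n m ?w \<le> HB2 k n m"
    unfolding HB2_def by (rule Max_ge[OF finite_hole_counts])
  moreover have "num_holes n m ?w = n * m - card (A \<union> B)"
    using assms by (intro num_holes_two_letter_word) (simp add: difference_cover_def)
  ultimately show ?thesis
    using card_Un_le[of A B] by linarith
qed

section \<open>One-dimensional covers\<close>

definition final_marks :: "nat \<Rightarrow> nat \<Rightarrow> int set" where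
  "final_marks p N = {int (N - p)..<int N}"

definition end_marks :: "nat \<Rightarrow> nat \<Rightarrow> int set" where
  "end_marks p N = {0..<int p} \<union> final_marks p N"

definition spaced_marks :: "nat \<Rightarrow> nat \<Rightarrow> int set" where
  "spaced_marks p N = {c \<in> {0..<int N}. int p dvd c \<or> c = int N - 1}"

lemma spaced_marks_subset: "spaced_marks p N \<subseteq> {0..<int N}"
  by (auto simp: spaced_marks_def)

text \<open>The mark \<open>N - 1\<close> stands in for the multiples of \<open>p\<close> from \<open>N\<close> on, hence the minimum below.\<close>

lemma differences_interval_spaced_marks:
  assumes "0 < p" "0 < N"
  shows "differences {s..<s + int p} (spaced_marks p N) = {s - int N<..<s + int p}"
proof
  show "differences {s..<s + int p} (spaced_marks p N) \<subseteq> {s - int N<..<s + int p}"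
    using spaced_marks_subset[of p N] by (fastforce simp: in_differences_iff)
  show "{s - int N<..<s + int p} \<subseteq> differences {s..<s + int p} (spaced_marks p N)"
  proof
    fix y assume y: "y \<in> {s - int N<..<s + int p}"
    define c where "c = (y - s) mod int p - (y - s)"
    define b where "b = min c (int N - 1)"
    have multiple: "int p dvd c"
      unfolding c_def by (subst dvd_diff_commute) (rule dvd_minus_mod)
    have window: "s - y \<le> c" "c < s - y + int p"
      using assms pos_mod_sign[of "int p" "y - s"] pos_mod_bound[of "int p" "y - s"]
      unfolding c_def by linarith+
    have "0 \<le> c"
    proof (rule ccontr)
      assume "\<not> 0 \<le> c"
      then have "int p \<le> - c" using multiple by (intro zdvd_imp_le) simp_all
      then show False using window y by simp
    qed
    then have "b \<in> spaced_marks p N"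
      using multiple assms(2) by (auto simp: b_def spaced_marks_def min_def)
    moreover have "b + y \<in> {s..<s + int p}"
      using window y by (auto simp: b_def)
    ultimately show "y \<in> differences {s..<s + int p} (spaced_marks p N)"
      using differencesI[of "b + y" _ b] by simp
  qed
qed

lemma differences_final_marks_spaced_marks:
  assumes "0 < p" "p \<le> N" "0 < K"
  shows "differences (final_marks p N) (spaced_marks p K) = {int N - int p - int K<..<int N}"
  using differences_interval_spaced_marks[of p K "int (N - p)"] assms
  by (simp add: final_marks_def of_nat_diff)

lemma differences_end_marks_spaced_marks:
  assumes "0 < p" "p \<le> N"
  shows "differences (end_marks p N) (spaced_marks p N) = {- int N<..<int N}"
  using differences_interval_spaced_marks[of p N 0]
    differences_final_marks_spaced_marks[of p N N] assms
  by (auto simp: end_marks_def differences_Un_left)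

definition positive_difference_cover :: "nat \<Rightarrow> int set \<Rightarrow> int set \<Rightarrow> bool" where
  "positive_difference_cover N X Y \<longleftrightarrow> X \<subseteq> {0..<int N} \<and> Y \<subseteq> {0..<int N} \<and> X \<inter> Y = {} \<and>
     {0<..<int N} \<subseteq> differences X Y"

lemma positive_difference_cover_marks:
  assumes "0 < p" "p < N \<or> N = 1"
  shows "positive_difference_cover N (final_marks p N) (spaced_marks p (N - p))"
proof -
  have "{0<..<int N} \<subseteq> differences (final_marks p N) (spaced_marks p (N - p))"
    using assms differences_final_marks_spaced_marks[of p N "N - p"] by (auto simp: of_nat_diff)
  then show ?thesis
    using spaced_marks_subset[of p "N - p"]
    by (fastforce simp: positive_difference_cover_def final_marks_def)
qed

lemma card_final_marks_le: "card (final_marks p N) \<le> p"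
  by (simp add: final_marks_def)

lemma card_end_marks_le: "card (end_marks p N) \<le> 2 * p"
  using card_Un_le[of "{0..<int p}" "final_marks p N"] card_final_marks_le[of p N]
  by (simp add: end_marks_def)

lemma card_spaced_marks_le:
  assumes "0 < p"
  shows "card (spaced_marks p N) \<le> N div p + 2"
proof -
  let ?multiples = "(\<lambda>j. int (p * j)) ` {..N div p}"
  have "spaced_marks p N \<subseteq> insert (int N - 1) ?multiples"
  proof
    fix c assume c: "c \<in> spaced_marks p N"
    then obtain i where i: "c = int i" "i < N"
      by (metis spaced_marks_subset subsetD atLeastLessThan_iff zero_le_imp_eq_int of_nat_less_iff)
    have "int i \<in> ?multiples" if "p dvd i"
    proof (rule image_eqI)
      show "int i = int (p * (i div p))" using that by simp
      show "i div p \<in> {..N div p}" using i by (simp add: div_le_mono)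
    qed
    then show "c \<in> insert (int N - 1) ?multiples"
      using c i by (auto simp: spaced_marks_def)
  qed
  then have "card (spaced_marks p N) \<le> card (insert (int N - 1) ?multiples)"
    by (intro card_mono) simp_all
  also have "\<dots> \<le> Suc (card ?multiples)"
    by (simp add: card_insert_if)
  also have "\<dots> \<le> N div p + 2"
    using card_image_le[of "{..N div p}" "\<lambda>j. int (p * j)"] by simp
  finally show ?thesis .
qed

section \<open>The product construction\<close>

lemma displacements_half:
  assumes "v \<in> displacements n m" "v \<noteq> 0"
  shows "v \<in> {0<..<int n} \<times> {- int m<..<int m} \<union> {0} \<times> {0<..<int m} \<or>
    - v \<in> {0<..<int n} \<times> {- int m<..<int m} \<union> {0} \<times> {0<..<int m}"
  using assms by (cases v) (auto simp: displacements_def zero_prod_def)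

lemma difference_cover_product:
  assumes rows: "positive_difference_cover n X Y"
    and spare: "r \<in> {0..<int n}" "r \<notin> X \<union> Y"
    and cols: "E \<subseteq> {0..<int m}" "S \<subseteq> {0..<int m}" "{- int m<..<int m} \<subseteq> differences E S"
    and spare_cols: "positive_difference_cover m U V" "U \<noteq> {}"
  shows "difference_cover n m (X \<times> E \<union> {r} \<times> U) (Y \<times> S \<union> {r} \<times> V)"
    (is "difference_cover n m ?A ?B")
proof -
  have "{0<..<int n} \<times> {- int m<..<int m} \<subseteq> differences (X \<times> E) (Y \<times> S)"
    using rows cols(3) by (auto simp: differences_Times positive_difference_cover_def)
  moreover have "{0} \<times> {0<..<int m} \<subseteq> differences ({r} \<times> U) ({r} \<times> V)"
    using spare_cols by (auto simp: differences_Times in_differences_iff positive_difference_cover_def)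
  ultimately have "{0<..<int n} \<times> {- int m<..<int m} \<union> {0} \<times> {0<..<int m} \<subseteq> differences ?A ?B"
    using differences_mono[of "X \<times> E" ?A "Y \<times> S" ?B]
      differences_mono[of "{r} \<times> U" ?A "{r} \<times> V" ?B] by blast
  then have "\<forall>v\<in>displacements n m. v \<noteq> 0 \<longrightarrow> v \<in> differences ?A ?B \<or> - v \<in> differences ?A ?B"
    using displacements_half by blast
  moreover have "?A \<subseteq> grid n m" "?B \<subseteq> grid n m" "?A \<inter> ?B = {}"
    using rows spare cols(1,2) spare_cols(1)
    by (auto simp: grid_def positive_difference_cover_def)
  ultimately show ?thesis
    using spare_cols(2) by (simp add: difference_cover_def)
qed

definition first_letter :: "nat \<Rightarrow> nat \<Rightarrow> nat \<Rightarrow> nat \<Rightarrow> (int \<times> int) set" where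
  "first_letter q p n m = final_marks q n \<times> end_marks p m \<union> {1} \<times> final_marks p m"

definition second_letter :: "nat \<Rightarrow> nat \<Rightarrow> nat \<Rightarrow> nat \<Rightarrow> (int \<times> int) set" where
  "second_letter q p n m =
     spaced_marks q (n - q) \<times> spaced_marks p m \<union> {1} \<times> spaced_marks p (m - p)"

lemma difference_cover_letters:
  assumes q: "2 \<le> q" "q + 3 \<le> n" and p: "0 < p" "p < m \<or> p = 1 \<and> m = 1"
  shows "difference_cover n m (first_letter q p n m) (second_letter q p n m)"
  unfolding first_letter_def second_letter_def
proof (rule difference_cover_product)
  show "positive_difference_cover n (final_marks q n) (spaced_marks q (n - q))"
    using q by (intro positive_difference_cover_marks) auto
  show "(1::int) \<in> {0..<int n}" "1 \<notin> final_marks q n \<union> spaced_marks q (n - q)"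
    using q by (auto simp: final_marks_def spaced_marks_def of_nat_diff)
  show "end_marks p m \<subseteq> {0..<int m}"
    using p by (auto simp: end_marks_def final_marks_def)
  show "{- int m<..<int m} \<subseteq> differences (end_marks p m) (spaced_marks p m)"
    using p by (subst differences_end_marks_spaced_marks) auto
  show "positive_difference_cover m (final_marks p m) (spaced_marks p (m - p))"
    using p by (intro positive_difference_cover_marks) auto
  show "final_marks p m \<noteq> {}"
    using p by (auto simp: final_marks_def)
qed (rule spaced_marks_subset)

lemma card_first_letter_le: "card (first_letter q p n m) \<le> q * (2 * p) + p"
proof -
  have "card (first_letter q p n m)
      \<le> card (final_marks q n \<times> end_marks p m) + card ({1 :: int} \<times> final_marks p m)"
    unfolding first_letter_def by (rule card_Un_le)
  also have "\<dots> \<le> q * (2 * p) + p"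
    unfolding card_cartesian_product
    by (intro add_le_mono mult_le_mono card_final_marks_le card_end_marks_le)
      (simp add: card_final_marks_le)
  finally show ?thesis .
qed

lemma card_second_letter_le:
  assumes "0 < q" "0 < p"
  shows "card (second_letter q p n m) \<le> (n div q + 3) * (m div p + 2)"
proof -
  have rows: "card (spaced_marks q (n - q)) \<le> n div q + 2"
    using card_spaced_marks_le[OF assms(1), of "n - q"] div_le_mono[of "n - q" n q] by simp
  have spare: "card (spaced_marks p (m - p)) \<le> m div p + 2"
    using card_spaced_marks_le[OF assms(2), of "m - p"] div_le_mono[of "m - p" m p] by simp
  have "card (second_letter q p n m)
      \<le> card (spaced_marks q (n - q) \<times> spaced_marks p m)
        + card ({1 :: int} \<times> spaced_marks p (m - p))"
    unfolding second_letter_def by (rule card_Un_le)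
  also have "\<dots> \<le> (n div q + 2) * (m div p + 2) + (m div p + 2)"
    using mult_le_mono[OF rows card_spaced_marks_le[OF assms(2), of m]] spare
    by (simp add: card_cartesian_product)
  finally show ?thesis by (simp add: algebra_simps)
qed

section \<open>The choice of parameters\<close>

lemma div_floor_sqrt_div_less:
  assumes "0 < k"
  shows "n div floor_sqrt (n div k) < k * (floor_sqrt (n div k) + 3)"
proof (cases "floor_sqrt (n div k) = 0")
  case True
  then show ?thesis using assms by simp
next
  case False
  define s where "s = floor_sqrt (n div k)"
  have s: "0 < s"
    using False unfolding s_def by simp
  have "n div k < (Suc s)\<^sup>2"
    unfolding s_def by (rule Suc_floor_sqrt_power2_gt)
  also have "\<dots> \<le> (s + 3) * s"
    using s by (simp add: power2_eq_square algebra_simps)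
  finally have "n < k * (s + 3) * s"
    using assms by (simp add: div_less_iff_less_mult mult.commute mult.left_commute)
  then show ?thesis
    using s by (simp add: div_less_iff_less_mult flip: s_def)
qed

lemma floor_sqrt_div_le_sqrt: "real (floor_sqrt (n div k)) \<le> sqrt (real n / real k)"
proof (rule real_le_rsqrt)
  have "(real (floor_sqrt (n div k)))\<^sup>2 \<le> real (n div k)"
    by (simp flip: of_nat_power)
  also have "\<dots> \<le> real n / real k"
    by (rule of_nat_div_le_of_nat)
  finally show "(real (floor_sqrt (n div k)))\<^sup>2 \<le> real n / real k" .
qed

lemma floor_sqrt_div_mult_floor_sqrt_le:
  "real (floor_sqrt (n div k)) * real (floor_sqrt m) \<le> sqrt (real n * real m / real k)"
proof -
  have "real (floor_sqrt (n div k)) * real (floor_sqrt m) \<le> sqrt (real n / real k) * sqrt (real m)"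
    using floor_sqrt_div_le_sqrt[of n k] floor_sqrt_div_le_sqrt[of m 1] by (intro mult_mono) simp_all
  then show ?thesis by (simp add: real_sqrt_mult real_sqrt_divide)
qed

lemma card_letters_le:
  assumes "0 < q" "0 < p" "n div q \<le> 2 * q + 5" "m div p \<le> p + 2"
  shows "card (first_letter q p n m) + card (second_letter q p n m)
    \<le> 4 * (q * p) + 8 * q + 9 * p + 32"
proof -
  have "card (second_letter q p n m) \<le> (n div q + 3) * (m div p + 2)"
    using assms by (intro card_second_letter_le)
  also have "\<dots> \<le> (2 * q + 8) * (p + 4)"
    using assms by (intro mult_le_mono) simp_all
  finally show ?thesis
    using card_first_letter_le[of q p n m] by (simp add: algebra_simps)
qed

lemma small_difference_cover:
  assumes n: "8 \<le> n" and m: "1 \<le> m"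
  obtains A B where "difference_cover n m A B"
    "real (card A + card B)
       \<le> 2 * sqrt 2 * sqrt (real n * real m) + 25 * (sqrt (real n) + sqrt (real m))"
proof
  define q where "q = floor_sqrt (n div 2)"
  define p where "p = floor_sqrt m"
  have "2 \<le> q"
    unfolding q_def using n by (intro le_floor_sqrtI) simp
  moreover have "q + 3 \<le> n"
    using floor_sqrt_le[of "n div 2"] n by (simp add: q_def)
  moreover have "0 < p"
    using m by (simp add: p_def)
  moreover have "p < m \<or> p = 1 \<and> m = 1"
    using m by (cases "m = 1")
      (simp_all add: p_def le_floor_sqrt_iff power2_eq_square flip: not_le)
  ultimately show "difference_cover n m (first_letter q p n m) (second_letter q p n m)"
    by (rule difference_cover_letters)
  have "n div q \<le> 2 * q + 5" "m div p \<le> p + 2"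
    using div_floor_sqrt_div_less[of 2 n] div_floor_sqrt_div_less[of 1 m]
    by (simp_all add: q_def p_def)
  then have "real (card (first_letter q p n m) + card (second_letter q p n m))
      \<le> real (4 * (q * p) + 8 * q + 9 * p + 32)"
    using \<open>2 \<le> q\<close> \<open>0 < p\<close> by (intro of_nat_mono card_letters_le) simp_all
  moreover have "real q \<le> sqrt (real n / 2)" "real p \<le> sqrt (real m)"
    using floor_sqrt_div_le_sqrt[of n 2] floor_sqrt_div_le_sqrt[of m 1]
    by (simp_all add: q_def p_def)
  moreover have "4 * (real q * real p) \<le> 2 * sqrt 2 * sqrt (real n * real m)"
  proof -
    have "real q * real p \<le> sqrt (real n * real m / 2)"
      using floor_sqrt_div_mult_floor_sqrt_le[of n 2 m] by (simp add: q_def p_def)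
    moreover have "4 * sqrt (real n * real m / 2) = 2 * sqrt 2 * sqrt (real n * real m)"
      by (simp add: real_sqrt_divide field_simps)
    ultimately show ?thesis by linarith
  qed
  moreover have "sqrt (real n / 2) \<le> sqrt (real n)" "1 \<le> sqrt (real n)" "1 \<le> sqrt (real m)"
    using n m by simp_all
  \<comment> \<open>\<open>25 = 9 + 16\<close>, since \<open>32 \<le> 16 (\<surd>n + \<surd>m)\<close>.\<close>
  ultimately show "real (card (first_letter q p n m) + card (second_letter q p n m))
      \<le> 2 * sqrt 2 * sqrt (real n * real m) + 25 * (sqrt (real n) + sqrt (real m))"
    unfolding of_nat_add of_nat_mult of_nat_numeral distrib_left by linarith
qed

lemma HB2_ge_if_8_le:
  assumes "8 \<le> n \<or> 8 \<le> m" "1 \<le> n" "1 \<le> m" "2 \<le> k"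
  shows "real n * real m \<le> real (HB2 k n m) +
    (2 * sqrt 2 * sqrt (real n * real m) + 25 * (sqrt (real n) + sqrt (real m)))"
    (is "_ \<le> _ + ?e")
proof -
  obtain A B where cover: "difference_cover n m A B" "real (card A + card B) \<le> ?e"
  proof (cases "8 \<le> n")
    case True
    then show ?thesis using small_difference_cover assms that by blast
  next
    case False
    then obtain A B where swapped: "difference_cover m n A B" "real (card A + card B) \<le> ?e"
      using small_difference_cover[of m n] assms by (auto simp: mult.commute add.commute)
    show ?thesis
      using that[OF difference_cover_swap[OF swapped(1)]] swapped(2) by (simp add: card_image)
  qed
  have "real (n * m) \<le> real (HB2 k n m + (card A + card B))"
    using HB2_ge_if_difference_cover[OF cover(1) assms(4)] by (rule of_nat_mono)
  then show ?thesis using cover(2) by simp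
qed

theorem theorem11:
  "\<exists>C::real. C > 0 \<and>
     (\<forall>k n m :: nat. k \<ge> 2 \<longrightarrow> n \<ge> 1 \<longrightarrow> m \<ge> 1 \<longrightarrow>
        real n * real m - 2 * sqrt 2 * sqrt (real n * real m) - C * (sqrt (real n) + sqrt (real m))
          \<le> real (HB2 k n m))"
proof (intro exI[of _ 25] conjI allI impI)
  fix k n m :: nat
  assume k: "k \<ge> 2" and n: "n \<ge> 1" and m: "m \<ge> 1"
  show "real n * real m - 2 * sqrt 2 * sqrt (real n * real m)
      - 25 * (sqrt (real n) + sqrt (real m)) \<le> real (HB2 k n m)"
  proof (cases "8 \<le> n \<or> 8 \<le> m")
    case True
    then show ?thesis using HB2_ge_if_8_le[OF _ n m k] by simp
  next
    case False
    then have "real n * real m \<le> 7 * 7" by (intro mult_mono) auto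
    moreover have "1 \<le> sqrt (real n)" "1 \<le> sqrt (real m)" "0 \<le> 2 * sqrt 2 * sqrt (real n * real m)"
      using n m by simp_all
    ultimately show ?thesis unfolding distrib_left by linarith
  qed
qed simp

end
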